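(* Let $0<q<1$ be fixed and, for a real sequence $\{f_n\}_{n\ge0}$, define the (formal) power series in $x$ $$f(a;x)=\sum_{n=0}^{\infty}f_n\frac{(a;q)_n}{(q;q)_n}x^n .$$ Suppose $\{f_n\}_{n\ge0}$ is doubly positive. Then the generalized Turánian $$\Delta_{f}(\alpha,\beta;x)=f(q^{\mu+\alpha};x)f(q^{\mu+\beta};x)-f(q^{\mu};x)f(q^{\mu+\alpha+\beta};x)$$ has positive coefficients at all positive powers of $x$ for all $\alpha,\beta>0$ and $\mu\ge0$. In particular, the function $\mu\mapsto f(q^{\mu};x)$ is log-concave on $[0,\infty)$ for each fixed $x>0$ in the domain of convergence.
   Context: For $0<q<1$ and complex $a$: $(a;q)_0=1$, $(a;q)_n=\prod_{k=0}^{n-1}(1-aq^k)$ for $n\ge1$. A sequence $\{f_n\}_{n\ge0}$ of nonnegative reals is doubly positive if it is nontrivial (not identically zero), is log-concave ($f_k^2\ge f_{k-1}f_{k+1}$ for all $k\ge1$), and has no internal zeros ($f_N=0$ implies that either $f_{N+i}=0$ for all $i\ge0$, or $f_{N-i}=0$ for $i=0,\dots,N$). A positive function is log-concave if its logarithm is concave.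
   Formalization: Coefficients at x^m, m≥1, are shown nonnegative, and positive when some f_i f_{m-i}>0 (for f=(1,0,0,…) the Turánian is 0). If f_0=0, the function is 0 at μ=0, so log-concavity is stated on (0,∞) together with value 0 at μ=0. *)

theory Defs
  imports "HOL-Analysis.Analysis"
begin

definition q_pochhammer :: "'a::comm_ring_1 \<Rightarrow> 'a \<Rightarrow> nat \<Rightarrow> 'a" where
  "q_pochhammer a q n = (\<Prod>k<n. 1 - a * q ^ k)"

definition doubly_positive :: "(nat \<Rightarrow> real) \<Rightarrow> bool" where
  "doubly_positive f \<longleftrightarrow>
     (\<forall>n. 0 \<le> f n) \<and>
     (\<exists>n. f n \<noteq> 0) \<and>
     (\<forall>k\<ge>1. f (k - 1) * f (k + 1) \<le> (f k)\<^sup>2) \<and>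
     (\<forall>N. f N = 0 \<longrightarrow> (\<forall>i. f (N + i) = 0) \<or> (\<forall>i\<le>N. f (N - i) = 0))"

definition log_concave_on :: "real set \<Rightarrow> (real \<Rightarrow> real) \<Rightarrow> bool" where
  "log_concave_on S F \<longleftrightarrow> (\<forall>x\<in>S. 0 < F x) \<and> concave_on S (\<lambda>x. ln (F x))"

definition q_series :: "'a::field \<Rightarrow> (nat \<Rightarrow> 'a) \<Rightarrow> 'a \<Rightarrow> 'a fps" where
  "q_series q f a = Abs_fps (\<lambda>n. f n * (q_pochhammer a q n / q_pochhammer q q n))"

definition q_turanian :: "real \<Rightarrow> (nat \<Rightarrow> real) \<Rightarrow> real \<Rightarrow> real \<Rightarrow> real \<Rightarrow> real fps" where
  "q_turanian q f \<mu> \<alpha> \<beta> =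
     q_series q f (q powr (\<mu> + \<alpha>)) * q_series q f (q powr (\<mu> + \<beta>)) -
     q_series q f (q powr \<mu>) * q_series q f (q powr (\<mu> + \<alpha> + \<beta>))"

end

theory Submission
  imports Defs
begin

text \<open>
  Write \<open>c\<^sub>n(a) = (a;q)\<^sub>n/(q;q)\<^sub>n\<close>, \<open>a = q\<^sup>\<mu>\<close>, \<open>A = q\<^sup>\<alpha>\<close>, \<open>B = q\<^sup>\<beta>\<close>. Expanding
  \<open>c\<^sub>k(aA)\<close> and \<open>c\<^sub>l(aBA)\<close> by the q-Vandermonde identity
  \<open>c\<^sub>n(uv) = \<Sum>\<^sub>k c\<^sub>k(u) u^(n-k) c\<^bsub>n-k\<^esub>(v)\<close> turns the coefficient of \<open>x^m\<close> in the Turanian into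
  the sum over \<open>i + j + s = m\<close> of
  \<open>c\<^sub>s(A) a^s c\<^sub>i(a) c\<^sub>j(aB) (f\<^bsub>i+s\<^esub> f\<^sub>j - B^s f\<^sub>i f\<^bsub>j+s\<^esub>)\<close>.
  After symmetrizing in \<open>i \<leftrightarrow> j\<close> every term is nonnegative: for \<open>i \<le> j\<close> both
  \<open>f\<^sub>i f\<^bsub>j+s\<^esub> \<le> f\<^bsub>i+s\<^esub> f\<^sub>j\<close> (log-concavity) and \<open>c\<^sub>j(a) c\<^sub>i(aB) \<le> c\<^sub>i(a) c\<^sub>j(aB)\<close> hold.
  For the sum of the series, the case \<open>\<alpha> = \<beta>\<close> is midpoint log-concavity in \<open>\<mu>\<close>, and continuity
  in \<open>\<mu>\<close> upgrades it to log-concavity.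
\<close>

section \<open>Ratios of q-shifted factorials and the q-Vandermonde identity\<close>

definition q_coeff :: "real \<Rightarrow> real \<Rightarrow> nat \<Rightarrow> real" where
  "q_coeff q a n = q_pochhammer a q n / q_pochhammer q q n"

lemma q_pochhammer_Suc: "q_pochhammer a q (Suc n) = q_pochhammer a q n * (1 - a * q ^ n)"
  by (simp add: q_pochhammer_def)

lemma q_coeff_0 [simp]: "q_coeff q a 0 = 1"
  by (simp add: q_coeff_def q_pochhammer_def)

lemma q_pochhammer_nonneg:
  fixes a q :: real
  assumes "0 \<le> a" "a \<le> 1" "0 \<le> q" "q \<le> 1"
  shows "0 \<le> q_pochhammer a q n"
proof -
  have "a * q ^ k \<le> 1" for k
    using assms by (intro mult_le_one power_le_one) auto
  then show ?thesis
    unfolding q_pochhammer_def by (intro prod_nonneg) auto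
qed

lemma q_pochhammer_pos:
  fixes a q :: real
  assumes "0 \<le> a" "a < 1" "0 \<le> q" "q \<le> 1"
  shows "0 < q_pochhammer a q n"
proof -
  have "a * q ^ k < 1" for k
    using mult_left_le[of "q ^ k" a] power_le_one[of q k] assms by linarith
  then show ?thesis
    unfolding q_pochhammer_def by (intro prod_pos) auto
qed

lemma q_pochhammer_antimono:
  fixes a b q :: real
  assumes "0 \<le> b" "b \<le> a" "a \<le> 1" "0 \<le> q" "q \<le> 1"
  shows "q_pochhammer a q n \<le> q_pochhammer b q n"
proof -
  have "a * q ^ k \<le> 1" for k
    using assms by (intro mult_le_one power_le_one) auto
  then show ?thesis
    unfolding q_pochhammer_def using assms by (intro prod_mono) (auto intro: mult_right_mono)
qed

text \<open>Going from \<open>n\<close> to \<open>Suc n\<close> multiplies the two sides by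
  \<open>1 - a * q ^ n\<close> and by the at least as large \<open>1 - b * q ^ n\<close>. The
  division-free form covers \<open>a = 1\<close>, where the factorials vanish for positive
  index.\<close>

lemma q_pochhammer_cross_le:
  fixes a b q :: real
  assumes "0 \<le> b" "b \<le> a" "a \<le> 1" "0 \<le> q" "q \<le> 1" and "i \<le> j"
  shows "q_pochhammer a q j * q_pochhammer b q i \<le> q_pochhammer a q i * q_pochhammer b q j"
  using \<open>i \<le> j\<close>
proof (induction j rule: dec_induct)
  case base
  then show ?case by simp
next
  case (step n)
  have "a * q ^ n \<le> 1" "b * q ^ n \<le> a * q ^ n"
    using assms by (auto intro!: mult_le_one power_le_one mult_right_mono)
  then have "q_pochhammer a q n * q_pochhammer b q i * (1 - a * q ^ n)
      \<le> q_pochhammer a q i * q_pochhammer b q n * (1 - b * q ^ n)"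
    using assms
    by (intro mult_mono step.IH mult_nonneg_nonneg q_pochhammer_nonneg) auto
  then show ?case
    by (simp add: q_pochhammer_Suc mult_ac)
qed

context
  fixes q :: real
  assumes q: "0 < q" "q < 1"
begin

lemma q_pochhammer_base_pos: "0 < q_pochhammer q q n"
  using q by (intro q_pochhammer_pos) auto

lemma q_coeff_nonneg: "0 \<le> a \<Longrightarrow> a \<le> 1 \<Longrightarrow> 0 \<le> q_coeff q a n"
  unfolding q_coeff_def using q q_pochhammer_base_pos[of n]
  by (intro divide_nonneg_pos q_pochhammer_nonneg) auto

lemma q_coeff_pos: "0 \<le> a \<Longrightarrow> a < 1 \<Longrightarrow> 0 < q_coeff q a n"
  unfolding q_coeff_def using q q_pochhammer_base_pos[of n]
  by (intro divide_pos_pos q_pochhammer_pos) auto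

lemma q_coeff_antimono:
  "0 \<le> b \<Longrightarrow> b \<le> a \<Longrightarrow> a \<le> 1 \<Longrightarrow> q_coeff q a n \<le> q_coeff q b n"
  unfolding q_coeff_def using q q_pochhammer_base_pos[of n]
  by (intro divide_right_mono q_pochhammer_antimono) auto

lemma q_coeff_cross_le:
  assumes "0 \<le> b" "b \<le> a" "a \<le> 1" "i \<le> j"
  shows "q_coeff q a j * q_coeff q b i \<le> q_coeff q a i * q_coeff q b j"
  using q_pochhammer_cross_le[of b a q i j] q_pochhammer_base_pos[of i] q_pochhammer_base_pos[of j]
    assms q
  by (simp add: q_coeff_def divide_simps mult_ac)

lemma q_coeff_Suc: "(1 - q ^ Suc n) * q_coeff q a (Suc n) = (1 - a * q ^ n) * q_coeff q a n"
  using q_pochhammer_base_pos[of n] q_pochhammer_base_pos[of "Suc n"]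
  by (simp add: q_coeff_def q_pochhammer_Suc field_simps)

text \<open>By the q-binomial theorem, \<open>q_coeff q a n\<close> is the coefficient of
  \<open>x^n\<close> in \<open>(ax;q)_inf / (x;q)_inf\<close>. The identity compares coefficients in
  \<open>(uvx)/(x) = (ux)/(x) * (uvx)/(ux)\<close>; the proof needs only the recurrence.\<close>

lemma q_coeff_mult:
  "q_coeff q (u * v) n = (\<Sum>k\<le>n. q_coeff q u k * (u ^ (n - k) * q_coeff q v (n - k)))"
proof (induction n)
  case 0
  then show ?case by simp
next
  case (Suc n)
  \<comment> \<open>Both sides satisfy the recurrence \<open>q_coeff_Suc\<close>; for the sum, split
    \<open>1 - q^(k+l) = (1 - q^k) + q^k (1 - q^l)\<close> and apply the recurrence to either factor.\<close>
  let ?c = "q_coeff q u" and ?d = "\<lambda>l. u ^ l * q_coeff q v l"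
  have d: "(1 - q ^ Suc l) * ?d (Suc l) = (u - u * v * q ^ l) * ?d l" for l
    using arg_cong[OF q_coeff_Suc[of l v], of "\<lambda>z. u ^ Suc l * z"] by (simp add: algebra_simps)
  have "(1 - q ^ Suc n) * (\<Sum>k\<le>Suc n. ?c k * ?d (Suc n - k))
      = (\<Sum>k\<le>Suc n. (1 - q ^ k) * ?c k * ?d (Suc n - k)
                  + q ^ k * ?c k * ((1 - q ^ (Suc n - k)) * ?d (Suc n - k)))"
    unfolding sum_distrib_left
  proof (rule sum.cong)
    fix k assume "k \<in> {..Suc n}"
    then have "q ^ Suc n = q ^ k * q ^ (Suc n - k)"
      by (simp flip: power_add)
    then show "(1 - q ^ Suc n) * (?c k * ?d (Suc n - k))
      = (1 - q ^ k) * ?c k * ?d (Suc n - k) + q ^ k * ?c k * ((1 - q ^ (Suc n - k)) * ?d (Suc n - k))"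
      by (simp only:) (simp add: algebra_simps)
  qed simp
  also have "\<dots> = (\<Sum>k\<le>Suc n. (1 - q ^ k) * ?c k * ?d (Suc n - k))
                 + (\<Sum>k\<le>Suc n. q ^ k * ?c k * ((1 - q ^ (Suc n - k)) * ?d (Suc n - k)))"
    by (rule sum.distrib)
  \<comment> \<open>The summand \<open>k = 0\<close> vanishes because \<open>1 - q ^ 0 = 0\<close>,
    so the index shifts by one; the other sum loses \<open>k = Suc n\<close> for the same
    reason.\<close>
  also have "(\<Sum>k\<le>Suc n. (1 - q ^ k) * ?c k * ?d (Suc n - k))
      = (\<Sum>k\<le>n. (1 - u * q ^ k) * ?c k * ?d (n - k))"
    unfolding sum.atMost_Suc_shift q_coeff_Suc by simp
  also have "(\<Sum>k\<le>Suc n. q ^ k * ?c k * ((1 - q ^ (Suc n - k)) * ?d (Suc n - k)))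
      = (\<Sum>k\<le>n. q ^ k * ?c k * ((1 - q ^ Suc (n - k)) * ?d (Suc (n - k))))"
    by (simp add: Suc_diff_le)
  also have "\<dots> = (\<Sum>k\<le>n. q ^ k * ?c k * ((u - u * v * q ^ (n - k)) * ?d (n - k)))"
    unfolding d ..
  also have "(\<Sum>k\<le>n. (1 - u * q ^ k) * ?c k * ?d (n - k)) + \<dots>
      = (\<Sum>k\<le>n. (1 - u * v * q ^ n) * (?c k * ?d (n - k)))"
    unfolding sum.distrib[symmetric]
  proof (rule sum.cong)
    fix k assume "k \<in> {..n}"
    then have "q ^ n = q ^ k * q ^ (n - k)"
      by (simp flip: power_add)
    then show "(1 - u * q ^ k) * ?c k * ?d (n - k) + q ^ k * ?c k * ((u - u * v * q ^ (n - k)) * ?d (n - k))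
       = (1 - u * v * q ^ n) * (?c k * ?d (n - k))"
      by (simp only:) (simp add: algebra_simps)
  qed simp
  also have "\<dots> = (1 - u * v * q ^ n) * q_coeff q (u * v) n"
    by (simp only: Suc.IH sum_distrib_left)
  also have "\<dots> = (1 - q ^ Suc n) * q_coeff q (u * v) (Suc n)"
    by (rule q_coeff_Suc[symmetric])
  finally have "(1 - q ^ Suc n) * (\<Sum>k\<le>Suc n. ?c k * ?d (Suc n - k))
      = (1 - q ^ Suc n) * q_coeff q (u * v) (Suc n)" .
  moreover have "1 - q ^ Suc n \<noteq> 0"
    using q power_Suc_less_one[of q n] by auto
  ultimately show ?case
    by (metis mult_cancel_left)
qed

end

section \<open>Doubly positive sequences\<close>

lemma doubly_positive_nonneg: "doubly_positive f \<Longrightarrow> 0 \<le> f n"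
  by (simp add: doubly_positive_def)

lemma doubly_positive_log_concave:
  assumes "doubly_positive f"
  shows "f n * f (Suc (Suc n)) \<le> (f (Suc n))\<^sup>2"
proof -
  have "\<forall>k\<ge>1. f (k - 1) * f (k + 1) \<le> (f k)\<^sup>2"
    using assms by (simp add: doubly_positive_def)
  from this[rule_format, of "Suc n"] show ?thesis by simp
qed

lemma doubly_positive_between:
  assumes "doubly_positive f" "0 < f i" "0 < f j" "i \<le> k" "k \<le> j"
  shows "0 < f k"
proof (rule ccontr)
  assume "\<not> 0 < f k"
  with doubly_positive_nonneg[OF assms(1)] have "f k = 0"
    by (simp add: order.antisym)
  with assms(1) have "(\<forall>l. f (k + l) = 0) \<or> (\<forall>l\<le>k. f (k - l) = 0)"
    unfolding doubly_positive_def by blast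
  then show False
  proof
    assume "\<forall>l. f (k + l) = 0"
    from spec[OF this, of "j - k"] show False using assms by simp
  next
    assume "\<forall>l\<le>k. f (k - l) = 0"
    from spec[OF this, of "k - i"] show False using assms by simp
  qed
qed

text \<open>Log-concavity makes the ratios \<open>f (Suc n) / f n\<close> nonincreasing. The
  cancelled factor \<open>f n\<close> is positive because it lies between two positive terms;
  otherwise the left side is zero.\<close>

lemma doubly_positive_step_le:
  assumes f: "doubly_positive f" and "i \<le> j"
  shows "f i * f (Suc j) \<le> f (Suc i) * f j"
  using \<open>i \<le> j\<close>
proof (induction j rule: dec_induct)
  case base
  then show ?case by simp
next
  case (step n)
  note nonneg = doubly_positive_nonneg[OF f]
  show ?case
  proof (cases "f i = 0 \<or> f (Suc (Suc n)) = 0")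
    case True
    then show ?thesis by (auto simp: nonneg)
  next
    case False
    then have "0 < f i" "0 < f (Suc (Suc n))"
      using nonneg[of i] nonneg[of "Suc (Suc n)"] by auto
    then have pos: "0 < f n"
      using doubly_positive_between[OF f, of i "Suc (Suc n)" n] step by simp
    have lc: "f n * f (Suc (Suc n)) \<le> f (Suc n) * f (Suc n)"
      using doubly_positive_log_concave[OF f, of n] by (simp add: power2_eq_square)
    have "f n * (f i * f (Suc (Suc n))) \<le> f i * f (Suc n) * f (Suc n)"
      using mult_left_mono[OF lc nonneg[of i]] by (simp add: mult_ac)
    also have "\<dots> \<le> f n * (f (Suc i) * f (Suc n))"
      using mult_right_mono[OF step.IH nonneg[of "Suc n"]] by (simp add: mult_ac)
    finally show ?thesis
      using pos by simp
  qed
qed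

text \<open>Multiplies up the unit-shift inequality at the index pairs \<open>i + s\<close>,
  \<open>j + s\<close>, again cancelling only factors that lie between positive terms.\<close>

lemma doubly_positive_cross_le:
  assumes f: "doubly_positive f" and "i \<le> j"
  shows "f i * f (j + s) \<le> f (i + s) * f j"
proof (induction s)
  case 0
  then show ?case by simp
next
  case (Suc s)
  note nonneg = doubly_positive_nonneg[OF f]
  show ?case
  proof (cases "f i = 0 \<or> f (Suc (j + s)) = 0")
    case True
    then show ?thesis by (auto simp: nonneg)
  next
    case False
    then have "0 < f i" "0 < f (Suc (j + s))"
      using nonneg[of i] nonneg[of "Suc (j + s)"] by auto
    then have pos: "0 < f (i + s)" "0 < f (j + s)"
      using doubly_positive_between[OF f, of i "Suc (j + s)" "i + s"]
        doubly_positive_between[OF f, of i "Suc (j + s)" "j + s"] \<open>i \<le> j\<close> by auto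
    have "(f (i + s) * f (Suc (j + s))) * (f i * f (j + s))
        \<le> (f (Suc (i + s)) * f (j + s)) * (f (i + s) * f j)"
      using \<open>i \<le> j\<close>
      by (intro mult_mono Suc.IH doubly_positive_step_le[OF f] mult_nonneg_nonneg nonneg) auto
    then have "(f (i + s) * f (j + s)) * (f i * f (Suc (j + s)))
        \<le> (f (i + s) * f (j + s)) * (f (Suc (i + s)) * f j)"
      by (simp only: mult_ac)
    then show ?thesis
      using pos by simp
  qed
qed

section \<open>Symmetrization and positivity of the Turanian coefficients\<close>

text \<open>Bounds a summand plus its mirror image under swapping \<open>i\<close> and
  \<open>j\<close>: \<open>X\<close>, \<open>Y\<close> are the two products of q-coefficients,
  \<open>P\<close>, \<open>Q\<close> the two products of values of \<open>f\<close>, and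
  \<open>t = B ^ s\<close>. The bound on the right-hand side also yields strict positivity.\<close>

lemma cross_pair_lower_bound:
  fixes P Q X Y t :: real
  assumes "Q \<le> P" "Y \<le> X" "0 \<le> X" "0 \<le> Q" "0 \<le> Y" "0 \<le> t" "t \<le> 1"
  shows "(1 - t) * (X * P) \<le> X * (P - t * Q) + Y * (Q - t * P)"
proof -
  have "0 \<le> (P - Q) * (t * (X - Y)) + Q * Y * (1 - t)"
    using assms by (intro add_nonneg_nonneg mult_nonneg_nonneg) auto
  also have "\<dots> = X * (P - t * Q) + Y * (Q - t * P) - (1 - t) * (X * P)"
    by (simp add: algebra_simps)
  finally show ?thesis by simp
qed

definition triples :: "nat \<Rightarrow> (nat \<times> nat \<times> nat) set" where
  "triples m = {(i, j, s). i + j + s = m}"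

lemma finite_triples [simp]: "finite (triples m)"
  by (rule finite_subset[of _ "{..m} \<times> {..m} \<times> {..m}"]) (auto simp: triples_def)

lemma sum_triples_swap:
  "(\<Sum>(i, j, s)\<in>triples m. h i j s) = (\<Sum>(i, j, s)\<in>triples m. h j i s)"
  by (rule sum.reindex_bij_witness[of _ "\<lambda>(i, j, s). (j, i, s)" "\<lambda>(i, j, s). (j, i, s)"])
     (auto simp: triples_def)

text \<open>The expanded factor has index \<open>k = i + s\<close> here; in the companion lemma it
  is the complementary index \<open>m - k = j + s\<close>.\<close>

lemma sum_triples_left:
  "(\<Sum>k\<le>m. \<Sum>i\<le>k. h i (m - k) (k - i)) = (\<Sum>(i, j, s)\<in>triples m. h i j s)"
  unfolding sum.Sigma[OF finite_atMost ballI[OF finite_atMost]]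
  by (rule sum.reindex_bij_witness
        [of _ "\<lambda>(i, j, s). (i + s, i)" "\<lambda>(k, i). (i, m - k, k - i)"])
     (auto simp: triples_def)

lemma sum_triples_right:
  "(\<Sum>k\<le>m. \<Sum>j\<le>m - k. h k j (m - k - j)) = (\<Sum>(i, j, s)\<in>triples m. h i j s)"
  unfolding sum.Sigma[OF finite_atMost ballI[OF finite_atMost]]
  by (rule sum.reindex_bij_witness
        [of _ "\<lambda>(i, j, s). (i, j)" "\<lambda>(k, j). (k, j, m - k - j)"])
     (auto simp: triples_def)

text \<open>Splitting off \<open>A\<close> in both products leaves the common factors
  \<open>q_coeff q A s\<close>, \<open>q_coeff q a i\<close> and \<open>q_coeff q (a * B) j\<close>;
  the powers \<open>a ^ s\<close> and \<open>(a * B) ^ s\<close> differ by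
  \<open>B ^ s\<close>.\<close>

lemma turanian_coeff_eq:
  assumes q: "0 < q" "q < 1"
  shows "(\<Sum>k\<le>m. f k * f (m - k) * (q_coeff q (a * A) k * q_coeff q (a * B) (m - k)
                               - q_coeff q a k * q_coeff q (a * B * A) (m - k)))
       = (\<Sum>(i, j, s)\<in>triples m. q_coeff q A s * a ^ s * (q_coeff q a i * q_coeff q (a * B) j
              * (f (i + s) * f j - B ^ s * (f i * f (j + s)))))"
proof -
  let ?c = "q_coeff q a" and ?d = "q_coeff q (a * B)" and ?e = "q_coeff q A"
  have "(\<Sum>k\<le>m. f k * f (m - k) * (q_coeff q (a * A) k * ?d (m - k)))
      = (\<Sum>k\<le>m. \<Sum>i\<le>k. f (i + (k - i)) * f (m - k) * ?c i * ?d (m - k) * ?e (k - i) * a ^ (k - i))"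
    unfolding q_coeff_mult[OF q, of a A]
    by (intro sum.cong refl) (simp add: sum_distrib_left sum_distrib_right mult_ac)
  also have "\<dots> = (\<Sum>(i, j, s)\<in>triples m. f (i + s) * f j * ?c i * ?d j * ?e s * a ^ s)"
    by (rule sum_triples_left)
  finally have 1: "(\<Sum>k\<le>m. f k * f (m - k) * (q_coeff q (a * A) k * ?d (m - k))) = \<dots>" .
  have "(\<Sum>k\<le>m. f k * f (m - k) * (?c k * q_coeff q (a * B * A) (m - k)))
      = (\<Sum>k\<le>m. \<Sum>j\<le>m - k. f k * f (j + (m - k - j)) * ?c k * ?d j * ?e (m - k - j) * (a * B) ^ (m - k - j))"
    unfolding q_coeff_mult[OF q, of "a * B" A]
    by (intro sum.cong refl) (simp add: sum_distrib_left mult_ac)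
  also have "\<dots> = (\<Sum>(i, j, s)\<in>triples m. f i * f (j + s) * ?c i * ?d j * ?e s * (a * B) ^ s)"
    by (rule sum_triples_right)
  finally have 2: "(\<Sum>k\<le>m. f k * f (m - k) * (?c k * q_coeff q (a * B * A) (m - k))) = \<dots>" .
  show ?thesis
    unfolding right_diff_distrib sum_subtractf 1 2 unfolding sum_subtractf[symmetric]
    by (intro sum.cong refl) (auto simp: algebra_simps power_mult_distrib)
qed

lemma turanian_sum_nonneg_pos:
  assumes q: "0 < q" "q < 1" and f: "doubly_positive f"
    and a: "0 < a" "a \<le> 1" and A: "0 < A" "A < 1" and B: "0 < B" "B < 1" and "1 \<le> m"
  defines "T \<equiv> (\<Sum>k\<le>m. f k * f (m - k) * (q_coeff q (a * A) k * q_coeff q (a * B) (m - k)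
                               - q_coeff q a k * q_coeff q (a * B * A) (m - k)))"
  shows "0 \<le> T" and "i0 \<le> m \<Longrightarrow> 0 < f i0 * f (m - i0) \<Longrightarrow> 0 < T"
proof -
  let ?c = "q_coeff q a" and ?d = "q_coeff q (a * B)" and ?e = "q_coeff q A"
  let ?w = "\<lambda>i j s. ?c i * ?d j * (f (i + s) * f j - B ^ s * (f i * f (j + s)))"
  let ?h = "\<lambda>i j s. ?e s * a ^ s * (?w i j s + ?w j i s)"
  have "2 * T = (\<Sum>(i, j, s)\<in>triples m. ?e s * a ^ s * ?w i j s)
              + (\<Sum>(i, j, s)\<in>triples m. ?e s * a ^ s * ?w j i s)"
    unfolding T_def turanian_coeff_eq[OF q]
    using sum_triples_swap[of "\<lambda>i j s. ?e s * a ^ s * ?w i j s" m] by simp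
  also have "\<dots> = (\<Sum>(i, j, s)\<in>triples m. ?h i j s)"
    unfolding sum.distrib[symmetric]
    by (intro sum.cong refl) (auto simp only: distrib_left split: prod.split)
  finally have T2: "2 * T = (\<Sum>(i, j, s)\<in>triples m. ?h i j s)" .
  note nonneg = doubly_positive_nonneg[OF f]
  have "a * B < a * 1"
    using a B by (intro mult_strict_left_mono)
  then have aB: "0 \<le> a * B" "a * B \<le> a" "a * B < 1"
    using a mult_pos_pos[OF a(1) B(1)] by linarith+
  have c: "0 \<le> ?c k" and d: "0 < ?d k" and e: "0 < ?e k" for k
    using q a A aB by (auto intro: q_coeff_nonneg q_coeff_pos)
  have w: "(1 - B ^ s) * (?c i * ?d j * (f (i + s) * f j)) \<le> ?w i j s + ?w j i s"
    if "i \<le> j" for i j s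
  proof -
    have "(1 - B ^ s) * (?c i * ?d j * (f (i + s) * f j))
        \<le> ?c i * ?d j * (f (i + s) * f j - B ^ s * (f i * f (j + s)))
        + ?c j * ?d i * (f i * f (j + s) - B ^ s * (f (i + s) * f j))"
    proof (rule cross_pair_lower_bound)
      show "?c j * ?d i \<le> ?c i * ?d j"
        using q a aB that by (intro q_coeff_cross_le) auto
      show "f i * f (j + s) \<le> f (i + s) * f j"
        using f that by (rule doubly_positive_cross_le)
    qed (use c d B nonneg in \<open>auto intro!: mult_nonneg_nonneg power_le_one simp: less_imp_le\<close>)
    then show ?thesis by (simp add: mult_ac)
  qed
  have w_nonneg: "0 \<le> ?w i j s + ?w j i s" for i j s
  proof -
    have *: "0 \<le> (1 - B ^ s) * (?c i * ?d j * (f (i + s) * f j))" for i j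
      using B c d nonneg by (intro mult_nonneg_nonneg) (auto simp: less_imp_le power_le_one)
    show ?thesis
    proof (cases "i \<le> j")
      case True
      then show ?thesis using w[of i j s] *[of i j] by linarith
    next
      case False
      then show ?thesis using w[of j i s] *[of j i] by linarith
    qed
  qed
  have h: "0 \<le> ?h i j s" for i j s
    using w_nonneg[of i j s] e[of s] a by (intro mult_nonneg_nonneg) auto
  have "0 \<le> 2 * T"
    unfolding T2 using h by (intro sum_nonneg) auto
  then show "0 \<le> T" by simp
  assume i0: "i0 \<le> m" "0 < f i0 * f (m - i0)"
  \<comment> \<open>The product is symmetric in \<open>i0\<close> and \<open>m - i0\<close>, and one
    of these is nonzero; \<open>1 \<le> s\<close> makes \<open>1 - B ^ s\<close> positive.\<close>
  obtain s where s: "1 \<le> s" "s \<le> m" "0 < f s * f (m - s)"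
    using i0 \<open>1 \<le> m\<close> that[of i0] that[of "m - i0"] by (cases "i0 = 0") (auto simp: mult.commute)
  \<comment> \<open>The triple has \<open>i = 0\<close> because \<open>?c 0 = 1\<close>, whereas
    \<open>?c i\<close> vanishes for positive \<open>i\<close> if \<open>a = 1\<close>.\<close>
  have "0 < (1 - B ^ s) * (?c 0 * ?d (m - s) * (f (0 + s) * f (m - s)))"
    using s B d[of "m - s"] power_Suc_less_one[of B "s - 1"] by simp
  also have "\<dots> \<le> ?w 0 (m - s) s + ?w (m - s) 0 s"
    by (rule w) simp
  finally have "0 < ?h 0 (m - s) s"
    using e[of s] a by (intro mult_pos_pos) auto
  then have "0 < 2 * T"
    unfolding T2 using h s
    by (intro sum_pos2[OF finite_triples, of "(0, m - s, s)"]) (auto simp: triples_def)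
  then show "0 < T" by simp
qed

section \<open>Coefficients of the formal series\<close>

lemma q_series_nth: "fps_nth (q_series q f a) n = f n * q_coeff q a n"
  by (simp add: q_series_def q_coeff_def)

lemma q_turanian_nth:
  assumes "0 < q"
  shows "fps_nth (q_turanian q f \<mu> \<alpha> \<beta>) m =
    (\<Sum>k\<le>m. f k * f (m - k) *
       (q_coeff q (q powr \<mu> * q powr \<alpha>) k * q_coeff q (q powr \<mu> * q powr \<beta>) (m - k)
      - q_coeff q (q powr \<mu>) k * q_coeff q (q powr \<mu> * q powr \<beta> * q powr \<alpha>) (m - k)))"
  unfolding q_turanian_def fps_sub_nth fps_mult_nth q_series_nth sum_subtractf[symmetric]
  by (intro sum.cong) (auto simp: powr_add algebra_simps)

lemma q_turanian_nth_nonneg_pos: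
  assumes "0 < q" "q < 1" "doubly_positive f" "0 < \<alpha>" "0 < \<beta>" "0 \<le> \<mu>" "1 \<le> m"
  shows "0 \<le> fps_nth (q_turanian q f \<mu> \<alpha> \<beta>) m"
    and "i \<le> m \<Longrightarrow> 0 < f i * f (m - i) \<Longrightarrow> 0 < fps_nth (q_turanian q f \<mu> \<alpha> \<beta>) m"
  unfolding q_turanian_nth[OF assms(1)] using assms
  by (auto intro!: turanian_sum_nonneg_pos powr_le1 simp: powr01_less_one)

section \<open>From midpoint concavity to concavity\<close>

lemma concave_on_if_midpoint_concave:
  fixes g :: "real \<Rightarrow> real"
  assumes "convex S" and cont: "continuous_on S g"
    and mid: "\<And>u h. 0 < h \<Longrightarrow> u - h \<in> S \<Longrightarrow> u + h \<in> S \<Longrightarrow> g (u - h) + g (u + h) \<le> 2 * g u"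
  shows "concave_on S g"
proof (rule concave_on_linorderI)
  show "convex S" by fact
  fix t x y :: real
  assume t: "0 < t" "t < 1" and xy: "x \<in> S" "y \<in> S" "x < y"
  then have sub: "{x..y} \<subseteq> S"
    using \<open>convex S\<close> by (metis closed_segment_subset closed_segment_eq_real_ivl1 less_imp_le)
  \<comment> \<open>\<open>p\<close> is the deviation of \<open>g\<close> from its chord over
    \<open>{x..y}\<close>. Subtracting an affine function keeps midpoint concavity, and the goal
    becomes nonnegativity of \<open>p\<close>.\<close>
  define c where "c = (g y - g x) / (y - x)"
  define p where "p = (\<lambda>z. g z - (g x + c * (z - x)))"
  have p_ends: "p x = 0" "p y = 0"
    using xy by (auto simp: p_def c_def)
  have p_cont: "continuous_on {x..y} p"
    unfolding p_def by (intro continuous_intros continuous_on_subset[OF cont sub])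
  \<comment> \<open>A negative minimum of \<open>p\<close> would violate midpoint concavity at its leftmost point.\<close>
  have p_nonneg: "0 \<le> p z" if "z \<in> {x..y}" for z
  proof (rule ccontr)
    assume "\<not> 0 \<le> p z"
    obtain t0 where t0: "t0 \<in> {x..y}" "\<And>z. z \<in> {x..y} \<Longrightarrow> p t0 \<le> p z"
      using continuous_attains_inf[OF _ _ p_cont] xy by auto
    with that \<open>\<not> 0 \<le> p z\<close> have neg: "p t0 < 0"
      by (meson leD leI order.trans)
    let ?K = "{z \<in> {x..y}. p z = p t0}"
    have "compact ({x..y} \<inter> ?K)"
      by (intro compact_Int_closed compact_Icc continuous_closed_preimage_constant[OF p_cont]) simp
    also have "{x..y} \<inter> ?K = ?K"
      by auto
    finally have "compact ?K" .
    then obtain a where a: "a \<in> ?K" "\<And>k. k \<in> ?K \<Longrightarrow> a \<le> k"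
      using compact_attains_inf[of ?K] t0(1) by blast
    have "a \<noteq> x" "a \<noteq> y"
      using a(1) neg p_ends by auto
    with a(1) have axy: "x < a" "a < y" by auto
    \<comment> \<open>The largest radius that keeps both points in \<open>{x..y}\<close>. Since
      \<open>a - h\<close> lies left of the leftmost minimizer, \<open>p\<close> is strictly larger
      there.\<close>
    define h where "h = min (a - x) (y - a)"
    have h: "0 < h" "a - h \<in> {x..y}" "a + h \<in> {x..y}"
      using axy by (auto simp: h_def)
    have "p (a - h) \<noteq> p t0"
      using a(2)[of "a - h"] h by auto
    then have "p t0 < p (a - h)" "p t0 \<le> p (a + h)"
      using t0(2) h by (auto simp: less_le)
    moreover have "p (a - h) + p (a + h) \<le> 2 * p a"
      using mid[of h a] h(1) subsetD[OF sub h(2)] subsetD[OF sub h(3)]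
      by (simp add: p_def algebra_simps)
    ultimately show False
      using a(1) by auto
  qed
  let ?z = "(1 - t) * x + t * y"
  have z: "?z - x = t * (y - x)"
    by (simp add: algebra_simps)
  have "0 \<le> t * (y - x)" "0 \<le> (1 - t) * (y - x)"
    using t xy by (auto intro!: mult_nonneg_nonneg)
  then have "?z \<in> {x..y}"
    by (simp add: algebra_simps)
  then have "g x + c * (t * (y - x)) \<le> g ?z"
    using p_nonneg[of ?z] by (simp add: p_def z)
  moreover have "c * (t * (y - x)) = t * (g y - g x)"
    using xy by (simp add: c_def)
  ultimately show "(1 - t) * g x + t * g y \<le> g ((1 - t) *\<^sub>R x + t *\<^sub>R y)"
    by (simp add: algebra_simps)
qed

section \<open>Sums of the series as functions of \<mu>\<close>

context
  fixes q x :: real and f :: "nat \<Rightarrow> real"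
  assumes q: "0 < q" "q < 1" and f: "doubly_positive f" and x: "0 < x"
    and summable: "\<And>\<mu>. 0 \<le> \<mu> \<Longrightarrow> summable (\<lambda>n. fps_nth (q_series q f (q powr \<mu>)) n * x ^ n)"
begin

lemma q_series_term_nonneg:
  assumes "0 \<le> \<mu>"
  shows "0 \<le> fps_nth (q_series q f (q powr \<mu>)) n * x ^ n"
  unfolding q_series_nth using q x assms
  by (intro mult_nonneg_nonneg doubly_positive_nonneg[OF f] q_coeff_nonneg powr_le1) auto

text \<open>One positive term suffices. At \<open>\<mu> = 0\<close> only the constant term survives,
  which is why \<open>0 < f 0\<close> is the alternative.\<close>

lemma eval_q_series_pos:
  assumes "0 < \<mu> \<or> 0 < f 0" "0 \<le> \<mu>"
  shows "0 < eval_fps (q_series q f (q powr \<mu>)) x"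
proof -
  obtain n where n: "0 < f n" "0 < q_coeff q (q powr \<mu>) n"
  proof (cases "0 < f 0")
    case True
    then show ?thesis using that[of 0] by simp
  next
    case False
    with assms have "0 < \<mu>" by simp
    then have "0 < q_coeff q (q powr \<mu>) n" for n
      using q by (intro q_coeff_pos) (auto simp: powr01_less_one)
    moreover obtain n where "f n \<noteq> 0"
      using f by (auto simp: doubly_positive_def)
    then have "0 < f n"
      using doubly_positive_nonneg[OF f, of n] by simp
    ultimately show ?thesis
      using that by blast
  qed
  then have "0 < fps_nth (q_series q f (q powr \<mu>)) n * x ^ n"
    using x by (simp add: q_series_nth)
  then show ?thesis
    unfolding eval_fps_def
    by (rule suminf_pos2[OF summable[OF assms(2)] q_series_term_nonneg[OF assms(2)]])
qed

text \<open>Each term is nondecreasing in \<mu>, so the series at \<open>M\<close> is a majorant for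
  the Weierstrass test on \<open>{0..M}\<close>.\<close>

lemma eval_q_series_continuous: "continuous_on {0..M} (\<lambda>\<mu>. eval_fps (q_series q f (q powr \<mu>)) x)"
proof (cases "0 \<le> M")
  case True
  have "uniform_limit {0..M} (\<lambda>n \<mu>. \<Sum>i<n. fps_nth (q_series q f (q powr \<mu>)) i * x ^ i)
     (\<lambda>\<mu>. \<Sum>i. fps_nth (q_series q f (q powr \<mu>)) i * x ^ i) sequentially"
  proof (rule Weierstrass_m_test)
    show "summable (\<lambda>n. fps_nth (q_series q f (q powr M)) n * x ^ n)"
      using True by (rule summable)
    fix n \<mu> assume \<mu>: "\<mu> \<in> {0..M}"
    then have "q_coeff q (q powr \<mu>) n \<le> q_coeff q (q powr M) n"
      using q by (intro q_coeff_antimono powr_mono' powr_le1) auto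
    then show "norm (fps_nth (q_series q f (q powr \<mu>)) n * x ^ n)
        \<le> fps_nth (q_series q f (q powr M)) n * x ^ n"
      using \<mu> x q_series_term_nonneg[of \<mu> n]
      by (auto simp: q_series_nth intro!: mult_right_mono mult_left_mono doubly_positive_nonneg[OF f])
  qed
  moreover have "continuous_on {0..M} (\<lambda>\<mu>. \<Sum>i<n. fps_nth (q_series q f (q powr \<mu>)) i * x ^ i)" for n
    unfolding q_series_nth q_coeff_def q_pochhammer_def[of "q powr _"]
    using q q_pochhammer_base_pos[OF q] by (intro continuous_intros) (auto simp: less_le)
  ultimately show ?thesis
    unfolding eval_fps_def by (intro uniform_limit_theorem[of _ _ sequentially]) auto
qed simp

text \<open>The series have nonnegative terms, so their products are Cauchy products, which are
  compared coefficient by coefficient.\<close>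

lemma eval_q_series_turan:
  assumes "0 \<le> \<mu>" "0 < \<alpha>" "0 < \<beta>"
  shows "eval_fps (q_series q f (q powr \<mu>)) x * eval_fps (q_series q f (q powr (\<mu> + \<alpha> + \<beta>))) x
    \<le> eval_fps (q_series q f (q powr (\<mu> + \<alpha>))) x * eval_fps (q_series q f (q powr (\<mu> + \<beta>))) x"
proof -
  have prod: "(\<lambda>m. fps_nth (q_series q f (q powr u) * q_series q f (q powr v)) m * x ^ m)
      sums (eval_fps (q_series q f (q powr u)) x * eval_fps (q_series q f (q powr v)) x)"
    if "0 \<le> u" "0 \<le> v" for u v
  proof -
    have "summable (\<lambda>n. norm (fps_nth (q_series q f (q powr w)) n * x ^ n))" if "0 \<le> w" for w
      using summable[OF that] q_series_term_nonneg[OF that] by simp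
    from Cauchy_product_sums[OF this[OF \<open>0 \<le> u\<close>] this[OF \<open>0 \<le> v\<close>]]
    have "(\<lambda>m. \<Sum>i\<le>m. fps_nth (q_series q f (q powr u)) i * x ^ i *
        (fps_nth (q_series q f (q powr v)) (m - i) * x ^ (m - i))) sums
      (eval_fps (q_series q f (q powr u)) x * eval_fps (q_series q f (q powr v)) x)"
      by (simp add: eval_fps_def)
    moreover have "(\<Sum>i\<le>m. fps_nth (q_series q f (q powr u)) i * x ^ i *
        (fps_nth (q_series q f (q powr v)) (m - i) * x ^ (m - i)))
       = fps_nth (q_series q f (q powr u) * q_series q f (q powr v)) m * x ^ m" for m
      unfolding fps_mult_nth sum_distrib_right atLeast0AtMost
    proof (rule sum.cong)
      fix i assume "i \<in> {..m}"
      then have "x ^ m = x ^ i * x ^ (m - i)" by (simp flip: power_add)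
      then show "fps_nth (q_series q f (q powr u)) i * x ^ i *
        (fps_nth (q_series q f (q powr v)) (m - i) * x ^ (m - i))
        = fps_nth (q_series q f (q powr u)) i * fps_nth (q_series q f (q powr v)) (m - i) * x ^ m"
        by (simp only: mult_ac)
    qed simp
    ultimately show ?thesis by simp
  qed
  show ?thesis
  proof (rule sums_le[OF _ prod prod])
    fix m
    have "0 \<le> fps_nth (q_turanian q f \<mu> \<alpha> \<beta>) m"
    proof (cases "m = 0")
      case True
      \<comment> \<open>Both products have constant coefficient \<open>f 0 * f 0\<close>.\<close>
      then show ?thesis using q by (simp add: q_turanian_nth)
    next
      case False
      then show ?thesis using q f assms by (intro q_turanian_nth_nonneg_pos) auto
    qed
    then show "fps_nth (q_series q f (q powr \<mu>) * q_series q f (q powr (\<mu> + \<alpha> + \<beta>))) m * x ^ m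
      \<le> fps_nth (q_series q f (q powr (\<mu> + \<alpha>)) * q_series q f (q powr (\<mu> + \<beta>))) m * x ^ m"
      using x by (intro mult_right_mono) (auto simp: q_turanian_def)
  qed (use assms in auto)
qed

text \<open>Keeping \<open>S\<close> general serves both \<open>{0..}\<close> and
  \<open>{0<..}\<close>. Midpoint concavity at \<open>u\<close> is the Turan inequality with base
  \<open>u - h\<close> and both shifts equal to \<open>h\<close>.\<close>

lemma log_concave_on_eval_q_series:
  assumes S: "convex S" "S \<subseteq> {0..}" and pos: "0 < f 0 \<or> S \<subseteq> {0<..}"
  shows "log_concave_on S (\<lambda>\<mu>. eval_fps (q_series q f (q powr \<mu>)) x)"
proof -
  let ?F = "\<lambda>\<mu>. eval_fps (q_series q f (q powr \<mu>)) x"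
  have F: "0 < ?F \<mu>" if "\<mu> \<in> S" for \<mu>
    using that S pos by (intro eval_q_series_pos) auto
  have cont: "continuous_on {0..} ?F"
    unfolding continuous_on_eq_continuous_within
  proof
    fix \<mu> :: real assume "\<mu> \<in> {0..}"
    then have "continuous (at \<mu> within {0..\<mu> + 1}) ?F"
      using eval_q_series_continuous[of "\<mu> + 1"] by (simp add: continuous_on_eq_continuous_within)
    moreover have "at \<mu> within {0..\<mu> + 1} = at \<mu> within {0..}"
      by (rule at_within_nhd[of _ "{..<\<mu> + 1}"]) auto
    ultimately show "continuous (at \<mu> within {0..}) ?F" by simp
  qed
  have "concave_on S (\<lambda>\<mu>. ln (?F \<mu>))"
  proof (rule concave_on_if_midpoint_concave[OF S(1)])
    show "continuous_on S (\<lambda>\<mu>. ln (?F \<mu>))"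
      using F by (intro continuous_on_ln continuous_on_subset[OF cont S(2)]) force
    fix u h :: real assume h: "0 < h" "u - h \<in> S" "u + h \<in> S"
    then have "closed_segment (u - h) (u + h) \<subseteq> S"
      using S(1) by (simp add: closed_segment_subset)
    then have "u \<in> S"
      using h by (auto simp: closed_segment_eq_real_ivl)
    have "?F (u - h) * ?F (u + h) \<le> ?F u * ?F u"
      using eval_q_series_turan[of "u - h" h h] h S(2) by auto
    then have "ln (?F (u - h) * ?F (u + h)) \<le> ln (?F u * ?F u)"
      using F[OF h(2)] F[OF h(3)] F[OF \<open>u \<in> S\<close>] by (subst ln_le_cancel_iff) auto
    then show "ln (?F (u - h)) + ln (?F (u + h)) \<le> 2 * ln (?F u)"
      using F[OF h(2)] F[OF h(3)] F[OF \<open>u \<in> S\<close>] by (simp add: ln_mult)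
  qed
  then show ?thesis
    using F by (simp add: log_concave_on_def)
qed

end

text \<open>For positive \<open>n\<close> the factor with \<open>k = 0\<close> in
  \<open>(1;q)_n\<close> is zero.\<close>

lemma eval_q_series_one:
  fixes q x :: real
  shows "eval_fps (q_series q f 1) x = f 0"
proof -
  have "q_coeff q 1 n = 0" if "n \<noteq> 0" for n
    using that unfolding q_coeff_def q_pochhammer_def[of 1] by (auto intro!: bexI[of _ 0])
  then have "(\<lambda>n. fps_nth (q_series q f 1) n * x ^ n) = (\<lambda>n. if n = 0 then f 0 else 0)"
    by (auto simp: q_series_nth)
  then show ?thesis
    using sums_unique[OF sums_single[of 0 "\<lambda>_. f 0"]] by (simp add: eval_fps_def)
qed

(* A doubly positive f may vanish outside an interval of indices. The m-th coefficient of the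
   Turanian is a linear combination of the products f i * f (m - i), so it is identically zero
   when all of these vanish; it is strictly positive in every other case with m >= 1.
   As (1;q)_n = 0 for n >= 1, the value of the series at \<mu> = 0 is f 0. If f 0 = 0, its
   logarithm there is -\<infinity>, and log-concavity on {0..} amounts to log-concavity on {0<..}. *)
theorem theorem1:
  fixes q :: real and f :: "nat \<Rightarrow> real"
  assumes "0 < q" and "q < 1"
    and "doubly_positive f"
  shows "(\<forall>\<alpha>>0. \<forall>\<beta>>0. \<forall>\<mu>\<ge>0. \<forall>m\<ge>1.
            0 \<le> fps_nth (q_turanian q f \<mu> \<alpha> \<beta>) m \<and>
            ((\<exists>i\<le>m. 0 < f i * f (m - i)) \<longrightarrow> 0 < fps_nth (q_turanian q f \<mu> \<alpha> \<beta>) m)) \<and>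
         (\<forall>x>0. (\<forall>\<mu>\<ge>0. summable (\<lambda>n. fps_nth (q_series q f (q powr \<mu>)) n * x ^ n)) \<longrightarrow>
            (0 < f 0 \<longrightarrow> log_concave_on {0..} (\<lambda>\<mu>. eval_fps (q_series q f (q powr \<mu>)) x)) \<and>
            (f 0 = 0 \<longrightarrow> eval_fps (q_series q f (q powr 0)) x = 0 \<and>
                         log_concave_on {0<..} (\<lambda>\<mu>. eval_fps (q_series q f (q powr \<mu>)) x)))"
proof (intro conjI allI impI)
  fix \<alpha> \<beta> \<mu> :: real and m :: nat
  assume *: "0 < \<alpha>" "0 < \<beta>" "0 \<le> \<mu>" "1 \<le> m"
  show "0 \<le> fps_nth (q_turanian q f \<mu> \<alpha> \<beta>) m"
    using assms * by (rule q_turanian_nth_nonneg_pos)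
  assume "\<exists>i\<le>m. 0 < f i * f (m - i)"
  then show "0 < fps_nth (q_turanian q f \<mu> \<alpha> \<beta>) m"
    using q_turanian_nth_nonneg_pos(2)[OF assms *] by blast
next
  fix x :: real
  assume x: "0 < x"
    and "\<forall>\<mu>\<ge>0. summable (\<lambda>n. fps_nth (q_series q f (q powr \<mu>)) n * x ^ n)"
  then have *: "log_concave_on S (\<lambda>\<mu>. eval_fps (q_series q f (q powr \<mu>)) x)"
    if "convex S" "S \<subseteq> {0..}" "0 < f 0 \<or> S \<subseteq> {0<..}" for S
    using assms x that by (intro log_concave_on_eval_q_series) auto
  show "log_concave_on {0..} (\<lambda>\<mu>. eval_fps (q_series q f (q powr \<mu>)) x)" if "0 < f 0"
    using that by (intro *) auto
  show "log_concave_on {0<..} (\<lambda>\<mu>. eval_fps (q_series q f (q powr \<mu>)) x)"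
    by (intro *) auto
  show "eval_fps (q_series q f (q powr 0)) x = 0" if "f 0 = 0"
    using that assms(1) by (simp add: eval_q_series_one)
qed

end
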